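(* The $D$-functions $\mathcal{D}^{\,j}_{m',m}$ ($j\in\{0,\frac12,1,\dots\}$, $m',m\in\{-j,\dots,j\}$) for $SL_h(2)$ are written in terms of Jacobi polynomials $P_n^{(\alpha,\beta)}$ as follows, where $z=-uv$ and $$N_+=\left\{\binom{j+m'}{m'-m}\binom{j-m}{m'-m}\right\}^{1/2},\qquad N_-=\left\{\binom{j-m'}{m-m'}\binom{j+m}{m-m'}\right\}^{1/2}.$$ (i) If $m'+m\ge0$, $m'\ge m$: $$\mathcal{D}^{\,j}_{m',m}=N_+\,P_{j-m'}^{(m'-m,\,m'+m)}(z)\;u\,(u+h(x+y)+h^2v)\cdots(u+h(m'-m-1)(x+y)+h^2(m'-m-1)^2v)$$ $$\qquad\times(x+h(m'-m)v)(x+h(m'-m+1)v)\cdots(x+h(2m'-1)v).$$ (ii) If $m'+m\ge0$, $m'\le m$: $$\mathcal{D}^{\,j}_{m',m}=N_-\,P_{j-m}^{(-m'+m,\,m'+m)}(z)\;x(x+hv)\cdots(x+h(m'+m-1)v)\;v^{-m'+m}.$$ (iii) If $m'+m\le0$, $m'\ge m$: $$\mathcal{D}^{\,j}_{m',m}=N_+\,P_{j+m}^{(m'-m,\,-m'-m)}(z)\;u\,(u+h(x+y)+h^2v)\cdots(u+h(m'-m-1)(x+y)+h^2(m'-m-1)^2v)$$ $$\qquad\times(y-h(m-m')v)(y-h(m-m'-1)v)\cdots(y-h(2m+1)v).$$ (iv) If $m'+m\le0$, $m'\le m$: $$\mathcal{D}^{\,j}_{m',m}=N_-\,P_{j+m'}^{(-m'+m,\,-m'-m)}(z)\;v^{-m'+m}\,(y-h(m-m')v)(y-h(m-m'-1)v)\cdots(y-h(2m+1)v).$$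 In these formulas the product of factors beginning with $u$ has $m'-m$ factors (the $i$-th being $u+h(i-1)(x+y)+h^2(i-1)^2v$), the product of $x$-type factors has $m'+m$ factors, and the product of $y$-type factors has $-m'-m$ factors; empty products equal $1$.
   Context: $SL_h(2)$: the Hopf algebra generated by $x,y,u,v$ with relations $[v,x]=hv^2$, $[u,x]=h(D-x^2)$, $[v,y]=hv^2$, $[u,y]=h(D-y^2)$, $[x,y]=h(xv-yv)$, $[v,u]=h(xv+vy)$, where $D=xy-uv-hxv$ is central, together with $D=1$. $h$ is the deformation parameter. $D$-functions of $SL_h(2)$: the elements $$\mathcal{D}^{\,j}_{m',m}=\{(j+m')!(j-m')!(j+m)!(j-m)!\}^{1/2}\sum_{K,L,M,N}\frac{U_M\,X_{K,M}\,Y_{K,M,N}\,v^L}{K!\,M!\,L!\,N!},$$ the sum being over nonnegative integers with $K+L=j+m$, $M+N=j-m$, $K+M=j+m'$, $L+N=j-m'$, where (ordered products, factors from left to right with increasing $i$) $U_M=\prod_{i=0}^{M-1}(u+h\,i\,(x+y)+h^2i^2v)$, $X_{K,M}=\prod_{i=0}^{K-1}(x+h(M+i)v)$, $Y_{K,M,N}=\prod_{i=0}^{N-1}(y-h(K-M-i)v)$. Jacobi polynomials (normalization used here): $P_n^{(\alpha,\beta)}(z)=\sum_{r\ge0}\frac{(-n)_r(\alpha+\beta+n+1)_r}{(1)_r(\alpha+1)_r}z^r$, with $(\alpha)_r=\alpha(\alpha+1)\cdots(\alpha+r-1)$. *)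

theory Defs
  imports
    Complex_Main
    "HOL-Library.Poly_Mapping"
    "HOL-Algebra.QuotRing"
    "HOL-Algebra.Algebraic_Closure_Type"
begin

section \<open>The free algebra on four generators\<close>

datatype gen = GenX | GenY | GenU | GenV

text \<open>Words in the generators form the free monoid, written additively because
  \<open>Poly_Mapping\<close> puts the convolution product on maps from an additive monoid.
  Thus \<open>word \<Rightarrow>\<^sub>0 complex\<close> is the free associative unital complex algebra
  on the four generators.\<close>

datatype word = Word "gen list"

instantiation word :: monoid_add
begin

definition zero_word :: word where "0 = Word []"

fun plus_word :: "word \<Rightarrow> word \<Rightarrow> word" where "Word a + Word b = Word (a @ b)"

instance
proof
  fix a b c :: word
  show "a + b + c = a + (b + c)" by (cases a; cases b; cases c) simp
  show "0 + a = a" "a + 0 = a" by (cases a; simp add: zero_word_def)+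
qed

end

type_synonym free_alg = "word \<Rightarrow>\<^sub>0 complex"

definition generator :: "gen \<Rightarrow> free_alg" where
  "generator g = Poly_Mapping.single (Word [g]) 1"

abbreviation "\<x> \<equiv> generator GenX"
abbreviation "\<y> \<equiv> generator GenY"
abbreviation "\<u> \<equiv> generator GenU"
abbreviation "\<v> \<equiv> generator GenV"

definition scale :: "complex \<Rightarrow> free_alg \<Rightarrow> free_alg" (infixr \<open>\<cdot>\<close> 75) where
  "c \<cdot> a = Poly_Mapping.single 0 c * a"

definition commutator :: "free_alg \<Rightarrow> free_alg \<Rightarrow> free_alg" where
  "commutator a b = a * b - b * a"

section \<open>The algebra \<open>SL\<^sub>h(2)\<close>\<close>

definition qdet :: "complex \<Rightarrow> free_alg" where
  "qdet h = \<x> * \<y> - \<u> * \<v> - h \<cdot> (\<x> * \<v>)"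

text \<open>Centrality of \<open>qdet h\<close> need not be imposed, since it is identified with \<open>1\<close>.\<close>

definition relators :: "complex \<Rightarrow> free_alg set" where
  "relators h =
    {commutator \<v> \<x> - h \<cdot> \<v>^2,
     commutator \<u> \<x> - h \<cdot> (qdet h - \<x>^2),
     commutator \<v> \<y> - h \<cdot> \<v>^2,
     commutator \<u> \<y> - h \<cdot> (qdet h - \<y>^2),
     commutator \<x> \<y> - h \<cdot> (\<x> * \<v> - \<y> * \<v>),
     commutator \<v> \<u> - h \<cdot> (\<x> * \<v> + \<v> * \<y>),
     qdet h - 1}"

abbreviation free_ring :: "free_alg ring" where
  "free_ring \<equiv> ring_of_type_algebra"

definition rel_ideal :: "complex \<Rightarrow> free_alg set" where
  "rel_ideal h = Idl\<^bsub>free_ring\<^esub> (relators h)"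

definition SLh :: "complex \<Rightarrow> free_alg set ring" where
  "SLh h = free_ring Quot (rel_ideal h)"

text \<open>The element of \<open>SL\<^sub>h(2)\<close> denoted by a noncommutative polynomial.\<close>

definition in_SLh :: "complex \<Rightarrow> free_alg \<Rightarrow> free_alg set" where
  "in_SLh h a = rel_ideal h +>\<^bsub>free_ring\<^esub> a"

lemma ring_free_ring: "ring free_ring"
proof (rule ringI)
  show "abelian_group free_ring"
  proof (rule abelian_groupI)
    fix a :: free_alg
    show "\<exists>b\<in>carrier free_ring. b \<oplus>\<^bsub>free_ring\<^esub> a = \<zero>\<^bsub>free_ring\<^esub>"
      by (rule bexI[of _ "- a"]) (simp_all add: ring_of_type_algebra_def)
  qed (simp_all add: ring_of_type_algebra_def algebra_simps)
  show "monoid free_ring"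
    by (rule monoidI) (simp_all add: ring_of_type_algebra_def algebra_simps)
qed (simp_all add: ring_of_type_algebra_def algebra_simps)

lemma carrier_free_ring: "carrier free_ring = UNIV"
  by (simp add: ring_of_type_algebra_def)

lemma rel_ideal_ideal: "ideal (rel_ideal h) free_ring"
  unfolding rel_ideal_def
  by (rule ring.genideal_ideal[OF ring_free_ring]) (simp add: carrier_free_ring)

lemma ring_SLh: "ring (SLh h)"
  unfolding SLh_def by (rule ideal.quotient_is_ring[OF rel_ideal_ideal])

lemma in_SLh_hom: "in_SLh h \<in> ring_hom free_ring (SLh h)"
  using ideal.rcos_ring_hom[OF rel_ideal_ideal, of h]
  by (simp add: SLh_def in_SLh_def[abs_def])

lemma in_SLh_surj: "range (in_SLh h) = carrier (SLh h)"
  by (auto simp: SLh_def in_SLh_def FactRing_def A_RCOSETS_def RCOSETS_def a_r_coset_def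
      carrier_free_ring)

lemma in_SLh_eq_iff: "in_SLh h a = in_SLh h b \<longleftrightarrow> a - b \<in> rel_ideal h"
proof -
  interpret R: ring free_ring by (rule ring_free_ring)
  have "\<ominus>\<^bsub>free_ring\<^esub> b = - b"
    by (rule R.minus_equality) (simp_all add: ring_of_type_algebra_def)
  then have "a \<ominus>\<^bsub>free_ring\<^esub> b = a - b"
    by (simp add: a_minus_def) (simp add: ring_of_type_algebra_def)
  then show ?thesis
    using R.quotient_eq_iff_same_a_r_cos[OF rel_ideal_ideal, of a b h]
    by (simp add: in_SLh_def carrier_free_ring)
qed

section \<open>The \<open>D\<close>-functions\<close>

definition spins :: "real set" where
  "spins = {j. \<exists>n::nat. j = real n / 2}"

definition weights :: "real \<Rightarrow> real set" where
  "weights j = {m. \<exists>k::nat. m = - j + real k \<and> m \<le> j}"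

text \<open>Sums and differences of spins and weights are real numbers here; \<open>nat_of\<close> is only
  meaningful on those that are nonnegative integers.\<close>

definition nat_of :: "real \<Rightarrow> nat" where
  "nat_of r = nat \<lfloor>r\<rfloor>"

text \<open>The ordered product \<open>f 0 * f 1 * \<dots> * f (n - 1)\<close>, from left to right.\<close>

definition ordered_prod :: "nat \<Rightarrow> (nat \<Rightarrow> free_alg) \<Rightarrow> free_alg" where
  "ordered_prod n f = prod_list (map f [0..<n])"

definition U_prod :: "complex \<Rightarrow> nat \<Rightarrow> free_alg" where
  "U_prod h M = ordered_prod M
     (\<lambda>i. \<u> + (h * of_nat i) \<cdot> (\<x> + \<y>) + (h^2 * of_nat i ^ 2) \<cdot> \<v>)"

definition X_prod :: "complex \<Rightarrow> nat \<Rightarrow> nat \<Rightarrow> free_alg" where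
  "X_prod h K M = ordered_prod K (\<lambda>i. \<x> + (h * (of_nat M + of_nat i)) \<cdot> \<v>)"

definition Y_prod :: "complex \<Rightarrow> nat \<Rightarrow> nat \<Rightarrow> nat \<Rightarrow> free_alg" where
  "Y_prod h K M N =
     ordered_prod N (\<lambda>i. \<y> - (h * (of_nat K - of_nat M - of_nat i)) \<cdot> \<v>)"

definition D_indices :: "real \<Rightarrow> real \<Rightarrow> real \<Rightarrow> (nat \<times> nat \<times> nat \<times> nat) set" where
  "D_indices j m' m = {(K, L, M, N).
     real K + real L = j + m \<and> real M + real N = j - m \<and>
     real K + real M = j + m' \<and> real L + real N = j - m'}"

lemma finite_D_indices: "finite (D_indices j m' m)"
proof (rule finite_subset)
  show "D_indices j m' m \<subseteq>
      {..nat_of (j + m)} \<times> {..nat_of (j + m)} \<times> {..nat_of (j - m)} \<times> {..nat_of (j - m)}"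
    by (auto simp: D_indices_def nat_of_def le_nat_iff le_floor_iff)
qed auto

definition D_fun :: "complex \<Rightarrow> real \<Rightarrow> real \<Rightarrow> real \<Rightarrow> free_alg set" where
  "D_fun h j m' m = in_SLh h
     (complex_of_real (sqrt (fact (nat_of (j + m')) * fact (nat_of (j - m')) *
                             fact (nat_of (j + m)) * fact (nat_of (j - m)))) \<cdot>
      (\<Sum>(K, L, M, N) \<in> D_indices j m' m.
         (1 / (fact K * fact M * fact L * fact N)) \<cdot>
           (U_prod h M * X_prod h K M * Y_prod h K M N * \<v>^L)))"

section \<open>Jacobi polynomials\<close>

text \<open>The normalization has value \<open>1\<close> at \<open>z = 0\<close>. The hypergeometric series is cut off at
  \<open>r = n\<close>, since \<open>pochhammer (- n) r = 0\<close> for \<open>r > n\<close>.\<close>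

definition jacobi :: "nat \<Rightarrow> real \<Rightarrow> real \<Rightarrow> free_alg \<Rightarrow> free_alg" where
  "jacobi n \<alpha> \<beta> z = (\<Sum>r\<le>n.
     complex_of_real (pochhammer (- real n) r * pochhammer (\<alpha> + \<beta> + real n + 1) r /
                      (pochhammer 1 r * pochhammer (\<alpha> + 1) r)) \<cdot> z^r)"

definition N_plus :: "real \<Rightarrow> real \<Rightarrow> real \<Rightarrow> complex" where
  "N_plus j m' m = complex_of_real (sqrt (real
     ((nat_of (j + m') choose nat_of (m' - m)) * (nat_of (j - m) choose nat_of (m' - m)))))"

definition N_minus :: "real \<Rightarrow> real \<Rightarrow> real \<Rightarrow> complex" where
  "N_minus j m' m = complex_of_real (sqrt (real
     ((nat_of (j - m') choose nat_of (m - m')) * (nat_of (j + m) choose nat_of (m - m')))))"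

end

theory Submission
  imports Defs
begin

text \<open>Write \<open>X\<^sub>a = x + hav\<close>, \<open>Y\<^sub>a = y + hav\<close> and \<open>U\<^sub>a = u + ha(x + y) + h\<^sup>2a\<^sup>2v\<close>. All factors of a
  \<open>D\<close>-function have this form, and the relations of the algebra say that the index behaves
  like a position: a factor \<open>v\<close> moving to the right raises the index of everything it passes,
  \<open>v X\<^sub>a = X\<^sub>a\<^sub>+\<^sub>1 v\<close>, \<open>v Y\<^sub>a = Y\<^sub>a\<^sub>+\<^sub>1 v\<close>, \<open>v U\<^sub>a = U\<^sub>a\<^sub>+\<^sub>1 v\<close>, while
  \<open>X\<^sub>a Y\<^sub>b = Y\<^sub>b\<^sub>+\<^sub>1 X\<^sub>a\<^sub>-\<^sub>1\<close>, so that \<open>x\<close> and \<open>y\<close> commute once each index is read relative to the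
  place of its factor. In the aligned case the determinant relation becomes
  \<open>X\<^sub>a Y\<^sub>a\<^sub>-\<^sub>1 = 1 + U\<^sub>a v\<close>.

  Consequently the factors \<open>X\<close> and \<open>Y\<close> of a summand cancel in pairs, each pair leaving a factor
  \<open>1 + U\<^sub>M v\<close> behind \<open>U\<^sub>0 \<dots> U\<^sub>M\<^sub>-\<^sub>1\<close>; there it can be moved to the front, where it becomes
  \<open>1 + uv = 1 - z\<close>. In the same way a pair of a factor \<open>U\<close> and a factor \<open>v\<close> becomes \<open>uv = -z\<close>
  in front. With \<open>n = j - max \<bar>m\<bar> \<bar>m'\<bar>\<close> the summands are therefore
  \<open>(1 - z)\<^sup>n\<^sup>-\<^sup>s (-z)\<^sup>s W\<close> for \<open>s = 0, \<dots>, n\<close>, up to numerical coefficients, with one and the same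
  right factor \<open>W\<close> (lemma \<open>D_term_cong\<close>). What remains is the identity
  \[ \sum_{s=0}^n \frac{(1-z)^{n-s}(-z)^s}{(n-s+b)!\,(s+a)!\,s!\,(n-s)!}
     = \frac{P_n^{(a,b)}(z)}{(n+b)!\,a!\,n!}, \]
  which is Vandermonde's convolution in each coefficient (lemma \<open>jacobi_bernstein_sum\<close>).
  The four formulas of the theorem are the four sign patterns of \<open>m' - m\<close> and \<open>m' + m\<close> in the
  single formula \<open>D_fun_eq_jacobi\<close>.\<close>

section \<open>Scalars in the free algebra\<close>

lemma scale_add_right: "c \<cdot> (a + b) = c \<cdot> a + c \<cdot> b"
  and scale_diff_right: "c \<cdot> (a - b) = c \<cdot> a - c \<cdot> b"
  and scale_minus_right: "c \<cdot> (- a) = - (c \<cdot> a)"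
  by (simp_all add: scale_def algebra_simps)

lemma scale_add_left: "(c + d) \<cdot> a = c \<cdot> a + d \<cdot> a"
  and scale_diff_left: "(c - d) \<cdot> a = c \<cdot> a - d \<cdot> a"
  and scale_minus_left: "(- c) \<cdot> a = - (c \<cdot> a)"
  by (simp_all add: scale_def single_add single_diff single_uminus algebra_simps)

lemma scale_scale: "c \<cdot> (d \<cdot> a) = (c * d) \<cdot> a"
  by (simp add: scale_def mult_single flip: mult.assoc)

lemma scale_one: "1 \<cdot> a = a"
  by (simp add: scale_def)

lemma scale_zero_left: "0 \<cdot> a = 0"
  by (simp add: scale_def)

lemma scale_mult_left: "(c \<cdot> a) * b = c \<cdot> (a * b)"
  by (simp add: scale_def mult.assoc)

lemma scalar_central: "a * Poly_Mapping.single 0 c = Poly_Mapping.single 0 c * (a :: free_alg)"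
proof (induction a rule: update_induct)
  case const
  then show ?case by simp
next
  case (update a w d)
  then have "Poly_Mapping.update w d a = a + Poly_Mapping.single w d"
    by (intro poly_mapping_eqI)
      (auto simp: lookup_update lookup_add lookup_single when_def in_keys_iff)
  then show ?case using update.IH by (simp add: mult_single algebra_simps)
qed

lemma scale_mult_right: "a * (c \<cdot> b) = c \<cdot> (a * b)"
  by (simp add: scale_def scalar_central flip: mult.assoc)

lemma scale_sum: "c \<cdot> sum f S = (\<Sum>i\<in>S. c \<cdot> f i)"
  by (simp add: scale_def sum_distrib_left)

lemma sum_scale: "(\<Sum>i\<in>S. c i \<cdot> a) = sum c S \<cdot> a"
  by (induction S rule: infinite_finite_induct) (simp_all add: scale_zero_left scale_add_left)

lemmas scale_simps = scale_add_right scale_diff_right scale_minus_right scale_add_left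
  scale_diff_left scale_minus_left scale_scale scale_mult_left scale_mult_right

section \<open>Congruence modulo the relations\<close>

text \<open>The computations take place in the free algebra, which is a type-class ring; passing to the
  quotient is postponed by working with this congruence.\<close>
definition cong_SLh :: "free_alg \<Rightarrow> complex \<Rightarrow> free_alg \<Rightarrow> bool"
    (\<open>(_ \<simeq>\<^bsub>_\<^esub> _)\<close> [51, 0, 51] 50) where
  "a \<simeq>\<^bsub>h\<^esub> b \<longleftrightarrow> in_SLh h a = in_SLh h b"

lemma cong_iff: "a \<simeq>\<^bsub>h\<^esub> b \<longleftrightarrow> a - b \<in> rel_ideal h"
  by (simp add: cong_SLh_def in_SLh_eq_iff)

lemma cong_refl [simp]: "a \<simeq>\<^bsub>h\<^esub> a"
  by (simp add: cong_SLh_def)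

lemma cong_sym: "a \<simeq>\<^bsub>h\<^esub> b \<Longrightarrow> b \<simeq>\<^bsub>h\<^esub> a"
  by (simp add: cong_SLh_def)

lemma cong_trans [trans]: "a \<simeq>\<^bsub>h\<^esub> b \<Longrightarrow> b \<simeq>\<^bsub>h\<^esub> c \<Longrightarrow> a \<simeq>\<^bsub>h\<^esub> c"
  by (simp add: cong_SLh_def)

text \<open>These two instances keep calculations from resorting to general substitution, whose
  higher-order unification is intractable on large sums.\<close>
lemma cong_eq_trans [trans]: "a \<simeq>\<^bsub>h\<^esub> b \<Longrightarrow> b = c \<Longrightarrow> a \<simeq>\<^bsub>h\<^esub> c"
  and eq_cong_trans [trans]: "a = b \<Longrightarrow> b \<simeq>\<^bsub>h\<^esub> c \<Longrightarrow> a \<simeq>\<^bsub>h\<^esub> c"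
  by simp_all

lemma in_SLh_add: "in_SLh h (a + b) = in_SLh h a \<oplus>\<^bsub>SLh h\<^esub> in_SLh h b"
  using ring_hom_add[OF in_SLh_hom, of a b h] by (simp add: ring_of_type_algebra_def)

lemma in_SLh_mult: "in_SLh h (a * b) = in_SLh h a \<otimes>\<^bsub>SLh h\<^esub> in_SLh h b"
  using ring_hom_mult[OF in_SLh_hom, of a b h] by (simp add: ring_of_type_algebra_def)

lemma cong_add: "a \<simeq>\<^bsub>h\<^esub> a' \<Longrightarrow> b \<simeq>\<^bsub>h\<^esub> b' \<Longrightarrow> a + b \<simeq>\<^bsub>h\<^esub> a' + b'"
  by (simp add: cong_SLh_def in_SLh_add)

lemma cong_mult: "a \<simeq>\<^bsub>h\<^esub> a' \<Longrightarrow> b \<simeq>\<^bsub>h\<^esub> b' \<Longrightarrow> a * b \<simeq>\<^bsub>h\<^esub> a' * b'"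
  by (simp add: cong_SLh_def in_SLh_mult)

lemma cong_mult_l: "b \<simeq>\<^bsub>h\<^esub> b' \<Longrightarrow> a * b \<simeq>\<^bsub>h\<^esub> a * b'"
  and cong_mult_r: "a \<simeq>\<^bsub>h\<^esub> a' \<Longrightarrow> a * b \<simeq>\<^bsub>h\<^esub> a' * b"
  by (simp_all add: cong_mult)

lemma cong_scale: "a \<simeq>\<^bsub>h\<^esub> b \<Longrightarrow> c \<cdot> a \<simeq>\<^bsub>h\<^esub> c \<cdot> b"
  by (simp add: scale_def cong_mult)

lemma cong_sum: "(\<And>i. i \<in> S \<Longrightarrow> f i \<simeq>\<^bsub>h\<^esub> g i) \<Longrightarrow> sum f S \<simeq>\<^bsub>h\<^esub> sum g S"
  by (induction S rule: infinite_finite_induct) (auto intro: cong_add)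

lemma cong_0_iff: "a \<simeq>\<^bsub>h\<^esub> b \<longleftrightarrow> a - b \<simeq>\<^bsub>h\<^esub> 0"
  by (simp add: cong_iff)

lemma relator_cong_0: "r \<in> relators h \<Longrightarrow> r \<simeq>\<^bsub>h\<^esub> 0"
  using ring.genideal_self[OF ring_free_ring, of "relators h"]
  by (auto simp: cong_iff rel_ideal_def carrier_free_ring)

text \<open>Each commutation rule below needs at most three relators, the first of them with coefficient
  \<open>1\<close>, and follows by comparing coefficients in the free algebra.\<close>
lemma cong_lin:
  assumes "a - b = r + c \<cdot> s + d \<cdot> t" "r \<in> relators h" "s \<in> relators h" "t \<in> relators h"
  shows "a \<simeq>\<^bsub>h\<^esub> b"
proof -
  have "r + c \<cdot> s + d \<cdot> t \<simeq>\<^bsub>h\<^esub> 0 + c \<cdot> 0 + d \<cdot> 0"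
    using assms(2-4) by (intro cong_add cong_scale relator_cong_0)
  then show ?thesis using assms(1) by (simp add: cong_0_iff[of a] scale_def)
qed

section \<open>Commutation rules\<close>

definition shift :: "complex \<Rightarrow> free_alg \<Rightarrow> complex \<Rightarrow> free_alg" where
  "shift h g a = g + (h * a) \<cdot> \<v>"

definition shift_u :: "complex \<Rightarrow> complex \<Rightarrow> free_alg" where
  "shift_u h a = \<u> + (h * a) \<cdot> (\<x> + \<y>) + (h^2 * a^2) \<cdot> \<v>"

lemma v_shift:
  assumes "g = \<x> \<or> g = \<y>"
  shows "\<v> * shift h g a \<simeq>\<^bsub>h\<^esub> shift h g (a + 1) * \<v>"
proof (rule cong_lin)
  let ?r = "commutator \<v> g - h \<cdot> \<v>^2"
  show "?r \<in> relators h" "?r \<in> relators h" "?r \<in> relators h"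
    using assms by (auto simp: relators_def)
  show "\<v> * shift h g a - shift h g (a + 1) * \<v> = ?r + 0 \<cdot> ?r + 0 \<cdot> ?r"
    by (simp add: shift_def commutator_def scale_simps scale_zero_left power2_eq_square
        algebra_simps)
qed

lemma v_shift_u: "\<v> * shift_u h a \<simeq>\<^bsub>h\<^esub> shift_u h (a + 1) * \<v>"
proof (rule cong_lin)
  show "\<v> * shift_u h a - shift_u h (a + 1) * \<v> =
      (commutator \<v> \<u> - h \<cdot> (\<x> * \<v> + \<v> * \<y>))
      + (h * a) \<cdot> (commutator \<v> \<x> - h \<cdot> \<v>^2)
      + (h * (a + 1)) \<cdot> (commutator \<v> \<y> - h \<cdot> \<v>^2)"
    by (simp add: shift_u_def commutator_def scale_simps power2_eq_square algebra_simps)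
      (simp add: mult_ac flip: scale_add_left)
qed (simp_all add: relators_def)

text \<open>The shifts of the indices compensate for the change of place: the sum of index and place is
  preserved for both factors.\<close>
lemma x_y_swap: "shift h \<x> a * shift h \<y> b \<simeq>\<^bsub>h\<^esub> shift h \<y> (b + 1) * shift h \<x> (a - 1)"
proof (rule cong_lin)
  show "shift h \<x> a * shift h \<y> b - shift h \<y> (b + 1) * shift h \<x> (a - 1) =
      (commutator \<x> \<y> - h \<cdot> (\<x> * \<v> - \<y> * \<v>))
      + (- (h * (b + 1))) \<cdot> (commutator \<v> \<x> - h \<cdot> \<v>^2)
      + (h * a) \<cdot> (commutator \<v> \<y> - h \<cdot> \<v>^2)"
    by (simp add: shift_def commutator_def scale_simps power2_eq_square algebra_simps)
qed (simp_all add: relators_def)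

text \<open>At \<open>a = 0\<close> this is the relation \<open>xy - uv - hxv = 1\<close>; the terms that depend on \<open>a\<close> differ
  between the two sides by a multiple of \<open>[v,y] - hv\<^sup>2\<close>.\<close>
lemma x_y_collapse: "shift h \<x> a * shift h \<y> (a - 1) \<simeq>\<^bsub>h\<^esub> 1 + shift_u h a * \<v>"
proof (rule cong_lin)
  show "shift h \<x> a * shift h \<y> (a - 1) - (1 + shift_u h a * \<v>) =
      (qdet h - 1) + (h * a) \<cdot> (commutator \<v> \<y> - h \<cdot> \<v>^2)
      + 0 \<cdot> (commutator \<v> \<y> - h \<cdot> \<v>^2)"
    by (simp add: shift_def shift_u_def qdet_def commutator_def scale_simps scale_zero_left
        power2_eq_square algebra_simps)
qed (simp_all add: relators_def)

section \<open>Ordered products\<close>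

lemma ordered_prod_0 [simp]: "ordered_prod 0 f = 1"
  by (simp add: ordered_prod_def)

lemma ordered_prod_Suc: "ordered_prod (Suc n) f = ordered_prod n f * f n"
  by (simp add: ordered_prod_def)

lemma ordered_prod_Suc_left: "ordered_prod (Suc n) f = f 0 * ordered_prod n (\<lambda>i. f (Suc i))"
  by (simp add: ordered_prod_def map_upt_Suc del: upt_Suc)

definition run :: "complex \<Rightarrow> free_alg \<Rightarrow> complex \<Rightarrow> nat \<Rightarrow> free_alg" where
  "run h g a n = ordered_prod n (\<lambda>i. shift h g (a + of_nat i))"

definition run_u :: "complex \<Rightarrow> complex \<Rightarrow> nat \<Rightarrow> free_alg" where
  "run_u h a n = ordered_prod n (\<lambda>i. shift_u h (a + of_nat i))"

lemma run_0 [simp]: "run h g a 0 = 1" "run_u h a 0 = 1"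
  by (simp_all add: run_def run_u_def)

lemma run_Suc: "run h g a (Suc n) = run h g a n * shift h g (a + of_nat n)"
  and run_u_Suc: "run_u h a (Suc n) = run_u h a n * shift_u h (a + of_nat n)"
  by (simp_all add: run_def run_u_def ordered_prod_Suc)

lemma run_Suc_left: "run h g a (Suc n) = shift h g a * run h g (a + 1) n"
  and run_u_Suc_left: "run_u h a (Suc n) = shift_u h a * run_u h (a + 1) n"
  by (simp_all add: run_def run_u_def ordered_prod_Suc_left add.assoc)

lemma v_run:
  assumes "g = \<x> \<or> g = \<y>"
  shows "\<v> * run h g a n \<simeq>\<^bsub>h\<^esub> run h g (a + 1) n * \<v>"
proof (induction n)
  case (Suc n)
  let ?b = "a + of_nat n"
  have "\<v> * run h g a (Suc n) = (\<v> * run h g a n) * shift h g ?b"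
    by (simp add: run_Suc mult.assoc)
  also have "\<dots> \<simeq>\<^bsub>h\<^esub> (run h g (a + 1) n * \<v>) * shift h g ?b"
    by (rule cong_mult_r[OF Suc])
  also have "\<dots> = run h g (a + 1) n * (\<v> * shift h g ?b)"
    by (simp add: mult.assoc)
  also have "\<dots> \<simeq>\<^bsub>h\<^esub> run h g (a + 1) n * (shift h g (?b + 1) * \<v>)"
    by (rule cong_mult_l[OF v_shift[OF assms]])
  also have "\<dots> = run h g (a + 1) (Suc n) * \<v>"
    by (simp add: run_Suc mult.assoc add.commute add.left_commute)
  finally show ?case .
qed simp

lemma v_run_u: "\<v> * run_u h a n \<simeq>\<^bsub>h\<^esub> run_u h (a + 1) n * \<v>"
proof (induction n)
  case (Suc n)
  let ?b = "a + of_nat n"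
  have "\<v> * run_u h a (Suc n) = (\<v> * run_u h a n) * shift_u h ?b"
    by (simp add: run_u_Suc mult.assoc)
  also have "\<dots> \<simeq>\<^bsub>h\<^esub> (run_u h (a + 1) n * \<v>) * shift_u h ?b"
    by (rule cong_mult_r[OF Suc])
  also have "\<dots> = run_u h (a + 1) n * (\<v> * shift_u h ?b)"
    by (simp add: mult.assoc)
  also have "\<dots> \<simeq>\<^bsub>h\<^esub> run_u h (a + 1) n * (shift_u h (?b + 1) * \<v>)"
    by (rule cong_mult_l[OF v_shift_u])
  also have "\<dots> = run_u h (a + 1) (Suc n) * \<v>"
    by (simp add: run_u_Suc mult.assoc add.commute add.left_commute)
  finally show ?case .
qed simp

lemma v_power_run:
  assumes "g = \<x> \<or> g = \<y>"
  shows "\<v> ^ L * run h g a n \<simeq>\<^bsub>h\<^esub> run h g (a + of_nat L) n * \<v> ^ L"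
proof (induction L)
  case (Suc L)
  have "\<v> ^ Suc L * run h g a n = \<v> * (\<v> ^ L * run h g a n)"
    by (simp add: mult.assoc)
  also have "\<dots> \<simeq>\<^bsub>h\<^esub> \<v> * (run h g (a + of_nat L) n * \<v> ^ L)"
    by (rule cong_mult_l[OF Suc])
  also have "\<dots> = (\<v> * run h g (a + of_nat L) n) * \<v> ^ L"
    by (simp add: mult.assoc)
  also have "\<dots> \<simeq>\<^bsub>h\<^esub> (run h g (a + of_nat L + 1) n * \<v>) * \<v> ^ L"
    by (rule cong_mult_r[OF v_run[OF assms]])
  also have "\<dots> = run h g (a + of_nat (Suc L)) n * \<v> ^ Suc L"
    by (simp add: mult.assoc add.commute add.left_commute)
  finally show ?case .
qed simp

lemma run_x_shift_y:
  "run h \<x> a n * shift h \<y> b \<simeq>\<^bsub>h\<^esub> shift h \<y> (b + of_nat n) * run h \<x> (a - 1) n"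
proof (induction n arbitrary: b)
  case (Suc n)
  have "run h \<x> a (Suc n) * shift h \<y> b = run h \<x> a n * (shift h \<x> (a + of_nat n) * shift h \<y> b)"
    by (simp add: run_Suc mult.assoc)
  also have "\<dots> \<simeq>\<^bsub>h\<^esub> run h \<x> a n * (shift h \<y> (b + 1) * shift h \<x> (a + of_nat n - 1))"
    by (rule cong_mult_l[OF x_y_swap])
  also have "\<dots> = (run h \<x> a n * shift h \<y> (b + 1)) * shift h \<x> (a + of_nat n - 1)"
    by (simp add: mult.assoc)
  also have "\<dots> \<simeq>\<^bsub>h\<^esub> (shift h \<y> (b + 1 + of_nat n) * run h \<x> (a - 1) n) * shift h \<x> (a + of_nat n - 1)"
    by (rule cong_mult_r[OF Suc])
  also have "\<dots> = shift h \<y> (b + of_nat (Suc n)) * run h \<x> (a - 1) (Suc n)"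
    by (simp add: run_Suc mult.assoc algebra_simps)
  finally show ?case .
qed simp

text \<open>When the leading \<open>y\<close>-factor has passed all \<open>x\<close>-factors but the first, its index \<open>a - K\<close> has
  risen to \<open>a - 1\<close>, so that it collapses against the first. The remaining product has the same shape, with one
  factor of either kind less and the same \<open>a\<close>. Truncated subtraction lets one
  formula describe both possible kinds of leftover factors.\<close>
lemma run_x_run_y:
  "run h \<x> a K * run h \<y> (a - of_nat K) N
    \<simeq>\<^bsub>h\<^esub> (1 + shift_u h a * \<v>) ^ min K N * (run h \<x> a (K - N) * run h \<y> a (N - K))"
proof (induction K arbitrary: N)
  case (Suc K)
  show ?case
  proof (cases N)
    case N: (Suc n)
    let ?b = "a - of_nat (Suc K)" and ?w = "1 + shift_u h a * \<v>"
    have b: "?b + of_nat K = a - 1" "?b + 1 = a - of_nat K"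
      by simp_all
    have "run h \<x> a (Suc K) * run h \<y> ?b N
        = shift h \<x> a * (run h \<x> (a + 1) K * shift h \<y> ?b) * run h \<y> (?b + 1) n"
      by (simp add: N run_Suc_left mult.assoc)
    also have "\<dots> \<simeq>\<^bsub>h\<^esub>
        shift h \<x> a * (shift h \<y> (a - 1) * run h \<x> a K) * run h \<y> (?b + 1) n"
      using run_x_shift_y[of h "a + 1" K ?b] unfolding b
      by (intro cong_mult_r cong_mult_l) simp
    also have "\<dots> = (shift h \<x> a * shift h \<y> (a - 1)) * (run h \<x> a K * run h \<y> (a - of_nat K) n)"
      unfolding b by (simp add: mult.assoc)
    also have "\<dots> \<simeq>\<^bsub>h\<^esub> ?w * (?w ^ min K n * (run h \<x> a (K - n) * run h \<y> a (n - K)))"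
      by (rule cong_mult[OF x_y_collapse Suc])
    also have "\<dots> = ?w ^ min (Suc K) N * (run h \<x> a (Suc K - N) * run h \<y> a (N - Suc K))"
      by (simp add: N mult.assoc)
    finally show ?thesis .
  qed simp
qed simp

lemma shift_u_0: "shift_u h 0 = \<u>"
  by (simp add: shift_u_def scale_zero_left)

text \<open>Here \<open>v\<close> turns \<open>U\<^sub>0 \<dots> U\<^sub>M\<^sub>-\<^sub>1\<close> into \<open>U\<^sub>1 \<dots> U\<^sub>M\<close>, and \<open>u = U\<^sub>0\<close> fills the gap in front. Read
  from right to left, the rule carries a trailing \<open>U\<^sub>M v\<close> to the front as \<open>uv\<close>.\<close>
lemma uv_run_u: "\<u> * \<v> * run_u h 0 M \<simeq>\<^bsub>h\<^esub> run_u h 0 (Suc M) * \<v>"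
  using cong_mult_l[OF v_run_u[of h 0 M], of \<u>]
  by (simp add: run_u_Suc_left shift_u_0 mult.assoc)

lemma run_u_collapse:
  "run_u h 0 M * (1 + shift_u h (of_nat M) * \<v>) ^ t \<simeq>\<^bsub>h\<^esub> (1 + \<u> * \<v>) ^ t * run_u h 0 M"
proof (induction t)
  case (Suc t)
  let ?w = "1 + shift_u h (of_nat M) * \<v>"
  have "run_u h 0 M * ?w ^ Suc t = (run_u h 0 M * ?w ^ t) * ?w"
    by (simp only: power_Suc2 mult.assoc)
  also have "\<dots> \<simeq>\<^bsub>h\<^esub> ((1 + \<u> * \<v>) ^ t * run_u h 0 M) * ?w"
    by (rule cong_mult_r[OF Suc])
  also have "\<dots> = (1 + \<u> * \<v>) ^ t * (run_u h 0 M + run_u h 0 (Suc M) * \<v>)"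
    by (simp add: run_u_Suc algebra_simps)
  also have "\<dots> \<simeq>\<^bsub>h\<^esub> (1 + \<u> * \<v>) ^ t * (run_u h 0 M + \<u> * \<v> * run_u h 0 M)"
    by (intro cong_mult_l cong_add cong_refl cong_sym[OF uv_run_u])
  also have "\<dots> = (1 + \<u> * \<v>) ^ Suc t * run_u h 0 M"
    by (simp only: power_Suc2 mult.assoc distrib_right mult_1_left)
  finally show ?case .
qed simp

lemma run_u_v_power: "run_u h 0 (r + A) * \<v> ^ r \<simeq>\<^bsub>h\<^esub> (\<u> * \<v>) ^ r * run_u h 0 A"
proof (induction r)
  case (Suc r)
  have "run_u h 0 (Suc r + A) * \<v> ^ Suc r = (run_u h 0 (Suc (r + A)) * \<v>) * \<v> ^ r"
    by (simp add: mult.assoc)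
  also have "\<dots> \<simeq>\<^bsub>h\<^esub> (\<u> * \<v> * run_u h 0 (r + A)) * \<v> ^ r"
    by (rule cong_mult_r[OF cong_sym[OF uv_run_u]])
  also have "\<dots> = \<u> * \<v> * (run_u h 0 (r + A) * \<v> ^ r)"
    by (simp add: mult.assoc)
  also have "\<dots> \<simeq>\<^bsub>h\<^esub> \<u> * \<v> * ((\<u> * \<v>) ^ r * run_u h 0 A)"
    by (rule cong_mult_l[OF Suc])
  also have "\<dots> = (\<u> * \<v>) ^ Suc r * run_u h 0 A"
    by (simp add: mult.assoc)
  finally show ?case .
qed simp

section \<open>The summands of a \<open>D\<close>-function\<close>

text \<open>The right factor \<open>W\<close> shared by all summands. At most one of \<open>A\<close>, \<open>B\<close> and at most one of
  \<open>C\<close>, \<open>E\<close> is nonzero where this is applied, being the positive and negative parts of \<open>m' - m\<close>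
  and \<open>m' + m\<close>; this makes the four cases instances of one expression.\<close>
definition residual :: "complex \<Rightarrow> nat \<Rightarrow> nat \<Rightarrow> nat \<Rightarrow> nat \<Rightarrow> free_alg" where
  "residual h A B C E =
     run_u h 0 A * (run h \<x> (of_nat A) C * run h \<y> (of_nat A) E) * \<v> ^ B"

lemma U_prod_eq_run_u: "U_prod h M = run_u h 0 M"
  by (simp add: U_prod_def run_u_def shift_u_def)

lemma X_prod_eq_run: "X_prod h K M = run h \<x> (of_nat M) K"
  by (simp add: X_prod_def run_def shift_def)

lemma Y_prod_eq_run: "Y_prod h K M N = run h \<y> (of_nat M - of_nat K) N"
proof -
  have "shift h \<y> (of_nat M - of_nat K + of_nat i)
      = \<y> - (h * (of_nat K - of_nat M - of_nat i)) \<cdot> \<v>" for i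
    by (simp add: shift_def scale_simps algebra_simps)
  then show ?thesis by (simp add: Y_prod_def run_def)
qed

text \<open>The \<open>x\<close>- and \<open>y\<close>-factors collapse \<open>t\<close> times, and the resulting powers move in front of the
  \<open>u\<close>-factors. Moving \<open>v\<^sup>r\<close> leftwards past the leftover factors lowers their indices from \<open>r + A\<close> to
  \<open>A\<close>, which removes the dependence on \<open>r\<close>, and then absorbs the last \<open>r\<close> of the \<open>u\<close>-factors.\<close>
lemma D_term_cong:
  assumes "C = 0 \<or> E = 0"
  shows "U_prod h (r + A) * X_prod h (t + C) (r + A) * Y_prod h (t + C) (r + A) (t + E) * \<v> ^ (r + B)
    \<simeq>\<^bsub>h\<^esub> (1 + \<u> * \<v>) ^ t * (\<u> * \<v>) ^ r * residual h A B C E"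
proof -
  let ?M = "of_nat (r + A) :: complex" and ?A = "of_nat A :: complex"
  let ?W = "run h \<x> ?M C * run h \<y> ?M E" and ?U = "run_u h 0 (r + A)"
  have red: "min (t + C) (t + E) = t" "t + C - (t + E) = C" "t + E - (t + C) = E"
    using assms by auto
  have W: "\<v> ^ r * (run h \<x> ?A C * run h \<y> ?A E) \<simeq>\<^bsub>h\<^esub> ?W * \<v> ^ r"
    using assms v_power_run[of \<x> r h ?A C] v_power_run[of \<y> r h ?A E]
    by (auto simp: add.commute)
  have "U_prod h (r + A) * X_prod h (t + C) (r + A) * Y_prod h (t + C) (r + A) (t + E) * \<v> ^ (r + B)
      = ?U * (run h \<x> ?M (t + C) * run h \<y> (?M - of_nat (t + C)) (t + E)) * (\<v> ^ r * \<v> ^ B)"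
    by (simp only: U_prod_eq_run_u X_prod_eq_run Y_prod_eq_run power_add mult.assoc)
  also have "\<dots> \<simeq>\<^bsub>h\<^esub> ?U * ((1 + shift_u h ?M * \<v>) ^ t * ?W) * (\<v> ^ r * \<v> ^ B)"
    using run_x_run_y[of h ?M "t + C" "t + E"] unfolding red by (intro cong_mult_r cong_mult_l)
  also have "\<dots> = (?U * (1 + shift_u h ?M * \<v>) ^ t) * (?W * \<v> ^ r) * \<v> ^ B"
    by (simp only: mult.assoc)
  also have "\<dots> \<simeq>\<^bsub>h\<^esub> ((1 + \<u> * \<v>) ^ t * ?U) * (\<v> ^ r * (run h \<x> ?A C * run h \<y> ?A E)) * \<v> ^ B"
    by (rule cong_mult_r[OF cong_mult[OF run_u_collapse cong_sym[OF W]]])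
  also have "\<dots> = (1 + \<u> * \<v>) ^ t * (?U * \<v> ^ r) * (run h \<x> ?A C * run h \<y> ?A E * \<v> ^ B)"
    by (simp only: mult.assoc)
  also have "\<dots> \<simeq>\<^bsub>h\<^esub> (1 + \<u> * \<v>) ^ t * ((\<u> * \<v>) ^ r * run_u h 0 A) * (run h \<x> ?A C * run h \<y> ?A E * \<v> ^ B)"
    by (rule cong_mult_r[OF cong_mult_l[OF run_u_v_power]])
  also have "\<dots> = (1 + \<u> * \<v>) ^ t * (\<u> * \<v>) ^ r * residual h A B C E"
    by (simp only: residual_def mult.assoc)
  finally show ?thesis .
qed

section \<open>Jacobi polynomials in powers of \<open>1 - z\<close> and \<open>-z\<close>\<close>

lemma choose_sum_shifted:
  "(\<Sum>s\<le>r. (r choose s) * (m choose (s + a))) = (m + r) choose (r + a)"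
proof -
  have "(m + r) choose (r + a) = (\<Sum>k\<le>r + a. (r choose k) * (m choose (r + a - k)))"
    by (simp add: vandermonde add.commute)
  also have "\<dots> = (\<Sum>k\<le>r. (r choose k) * (m choose (r + a - k)))"
    by (rule sum.mono_neutral_right) (auto simp: binomial_eq_0)
  also have "\<dots> = (\<Sum>s\<le>r. (r choose s) * (m choose (s + a)))"
    by (rule sum.reindex_bij_witness[of _ "\<lambda>s. r - s" "\<lambda>s. r - s"])
      (auto simp flip: binomial_symmetric)
  finally show ?thesis ..
qed

lemma pochhammer_Suc_fact: "pochhammer (real k + 1) r = fact (k + r) / fact k"
  using pochhammer_product'[of "1::real" k r] by (simp add: field_simps flip: pochhammer_fact)

lemma pochhammer_neg_fact: "r \<le> n \<Longrightarrow> pochhammer (- real n) r = (- 1) ^ r * fact n / fact (n - r)"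
  using pochhammer_Suc_fact[of "n - r" r] by (simp add: pochhammer_minus of_nat_diff add.commute)

definition jacobi_coeff :: "nat \<Rightarrow> nat \<Rightarrow> nat \<Rightarrow> nat \<Rightarrow> real" where
  "jacobi_coeff n a b r = pochhammer (- real n) r * pochhammer (real a + real b + real n + 1) r /
     (pochhammer 1 r * pochhammer (real a + 1) r)"

text \<open>The left-hand side is the coefficient of \<open>z\<^sup>r\<close> in the sum of \<open>jacobi_bernstein_sum\<close>. The
  factorials combine into \<open>(r choose s) * ((n + a + b) choose (s + a))\<close> times a factor
  independent of \<open>s\<close>, so that Vandermonde's convolution applies.\<close>
lemma jacobi_coeff_sum:
  assumes "r \<le> n"
  shows "(\<Sum>s\<le>r. (- 1) ^ r * real ((n - s) choose (r - s)) /
      (fact (n - s + b) * fact (s + a) * fact s * fact (n - s)))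
    = jacobi_coeff n a b r / (fact (n + b) * fact a * fact n)"
proof -
  let ?c = "(- 1) ^ r / (fact r * fact (n - r) * fact (n + a + b)) :: real"
  have cancel: "\<sigma> * (p / (q * t)) / (w * x * e * p) = \<sigma> / (g * t * k) * (g / (e * q) * (k / (x * w)))"
    if "p \<noteq> 0" "g \<noteq> 0" "k \<noteq> 0" for \<sigma> p q t w x e g k :: real
    using that by (simp add: divide_simps)
  have "(- 1) ^ r * real ((n - s) choose (r - s)) /
      (fact (n - s + b) * fact (s + a) * fact s * fact (n - s))
    = ?c * real ((r choose s) * ((n + a + b) choose (s + a)))" if "s \<le> r" for s
  proof -
    have b1: "real ((n - s) choose (r - s)) = fact (n - s) / (fact (r - s) * fact (n - r))"
      using that assms by (simp add: binomial_fact)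
    have b2: "real (r choose s) = fact r / (fact s * fact (r - s))"
      using that by (simp add: binomial_fact)
    have b3: "real ((n + a + b) choose (s + a)) = fact (n + a + b) / (fact (s + a) * fact (n - s + b))"
      using that assms by (simp add: binomial_fact)
    show ?thesis unfolding of_nat_mult b1 b2 b3 by (rule cancel) simp_all
  qed
  then have "(\<Sum>s\<le>r. (- 1) ^ r * real ((n - s) choose (r - s)) /
      (fact (n - s + b) * fact (s + a) * fact s * fact (n - s)))
    = (\<Sum>s\<le>r. ?c * real ((r choose s) * ((n + a + b) choose (s + a))))"
    by (intro sum.cong refl) simp
  also have "\<dots> = ?c * real ((n + a + b + r) choose (r + a))"
    unfolding sum_distrib_left[symmetric] of_nat_sum[symmetric] choose_sum_shifted ..
  also have "real ((n + a + b + r) choose (r + a)) = fact (n + a + b + r) / (fact (r + a) * fact (n + b))"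
    by (simp add: binomial_fact)
  also have "?c * \<dots> = jacobi_coeff n a b r / (fact (n + b) * fact a * fact n)"
  proof -
    have p1: "pochhammer (real a + real b + real n + 1) r = fact (n + a + b + r) / fact (n + a + b)"
      using pochhammer_Suc_fact[of "a + b + n" r] by (simp add: add_ac)
    have p2: "pochhammer (real a + 1) r = fact (r + a) / fact a"
      using pochhammer_Suc_fact[of a r] by (simp add: add_ac)
    show ?thesis
      unfolding jacobi_coeff_def p1 p2 pochhammer_neg_fact[OF assms] pochhammer_fact[symmetric]
      by (simp add: divide_simps)
  qed
  finally show ?thesis .
qed

text \<open>The binomial theorem of a commutative ring, for the subring generated by \<open>z\<close>.\<close>
lemma one_minus_power: "(1 - z) ^ n = (\<Sum>k\<le>n. ((- 1) ^ k * of_nat (n choose k)) \<cdot> z ^ k)"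
proof (induction n)
  case (Suc n)
  let ?f = "\<lambda>n k. ((- 1) ^ k * of_nat (n choose k)) \<cdot> z ^ k"
  have "(1 - z) ^ Suc n = (\<Sum>k\<le>n. ?f n k) - (\<Sum>k\<le>n. z * ?f n k)"
    by (simp only: power_Suc Suc left_diff_distrib mult_1_left sum_distrib_left sum_subtractf)
  also have "(\<Sum>k\<le>n. ?f n k) = (\<Sum>k\<le>Suc n. ?f n k)"
    by (simp add: scale_zero_left binomial_eq_0)
  also have "\<dots> = 1 + (\<Sum>k\<le>n. ?f n (Suc k))"
    by (subst sum.atMost_Suc_shift) (simp add: scale_one)
  also have "\<dots> - (\<Sum>k\<le>n. z * ?f n k) = 1 + (\<Sum>k\<le>n. ?f (Suc n) (Suc k))"
    by (simp add: scale_simps algebra_simps sum_subtractf sum.distrib sum_negf)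
  also have "\<dots> = (\<Sum>k\<le>Suc n. ?f (Suc n) k)"
    by (subst sum.atMost_Suc_shift) (simp add: scale_one)
  finally show ?case .
qed (simp add: scale_one)

lemma jacobi_eq: "jacobi n (real a) (real b) z = (\<Sum>r\<le>n. complex_of_real (jacobi_coeff n a b r) \<cdot> z ^ r)"
  by (simp add: jacobi_def jacobi_coeff_def)

text \<open>The expansion of the Jacobi polynomial in the Bernstein basis, up to signs. Both sides are
  polynomials in the single element \<open>z\<close>, so noncommutativity does not interfere.\<close>
lemma jacobi_bernstein_sum:
  "(\<Sum>s\<le>n. (1 / (fact (n - s + b) * fact (s + a) * fact s * fact (n - s))) \<cdot> ((1 - z) ^ (n - s) * (- z) ^ s))
    = (1 / (fact (n + b) * fact a * fact n)) \<cdot> jacobi n (real a) (real b) z"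
proof -
  let ?d = "\<lambda>s. fact (n - s + b) * fact (s + a) * fact s * fact (n - s)"
  let ?g = "\<lambda>s k. complex_of_real ((- 1) ^ (s + k) * real ((n - s) choose k) / ?d s) \<cdot> z ^ (s + k)"
  have neg: "(- z) ^ s = ((- 1) ^ s) \<cdot> z ^ s" for s
    by (induction s) (simp_all add: scale_simps scale_one)
  have expand: "(1 / ?d s) \<cdot> ((1 - z) ^ (n - s) * (- z) ^ s) = (\<Sum>k\<le>n - s. ?g s k)" for s
  proof -
    have "(1 / ?d s) \<cdot> ((((- 1) ^ k * of_nat ((n - s) choose k)) \<cdot> z ^ k) * (((- 1) ^ s) \<cdot> z ^ s)) = ?g s k"
      for k
    proof -
      have "z ^ k * z ^ s = z ^ (s + k)"
        by (simp add: add.commute flip: power_add)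
      moreover have "1 / ?d s * ((- 1) ^ s * ((- 1) ^ k * of_nat ((n - s) choose k)))
          = complex_of_real ((- 1) ^ (s + k) * real ((n - s) choose k) / ?d s)"
        by (simp add: power_add)
      ultimately show ?thesis
        by (simp only: scale_mult_left scale_mult_right scale_scale mult.assoc)
    qed
    then show ?thesis
      by (simp only: one_minus_power neg sum_distrib_right scale_sum)
  qed
  have "(\<Sum>s\<le>n. (1 / ?d s) \<cdot> ((1 - z) ^ (n - s) * (- z) ^ s)) = (\<Sum>s\<le>n. \<Sum>k\<le>n - s. ?g s k)"
    by (simp only: expand)
  also have "\<dots> = (\<Sum>(s, k)\<in>{(s, k). s + k \<le> n}. ?g s k)"
    by (subst sum.Sigma) (auto intro!: sum.cong)
  also have "\<dots> = (\<Sum>r\<le>n. \<Sum>s\<le>r. ?g s (r - s))"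
    by (rule sum.triangle_reindex_eq)
  also have "\<dots> = (\<Sum>r\<le>n. complex_of_real (\<Sum>s\<le>r. (- 1) ^ r * real ((n - s) choose (r - s)) / ?d s) \<cdot> z ^ r)"
    unfolding of_real_sum sum_scale[symmetric] by (intro sum.cong refl) simp
  also have "\<dots> = (\<Sum>r\<le>n. complex_of_real (jacobi_coeff n a b r / (fact (n + b) * fact a * fact n)) \<cdot> z ^ r)"
    by (intro sum.cong refl) (simp only: atMost_iff jacobi_coeff_sum)
  also have "\<dots> = (1 / (fact (n + b) * fact a * fact n)) \<cdot> jacobi n (real a) (real b) z"
    by (simp add: jacobi_eq scale_sum scale_scale)
  finally show ?thesis .
qed

section \<open>The closed form\<close>

text \<open>The numbers \<open>A\<close>, \<open>B\<close> are the positive and negative parts of \<open>m' - m\<close>, the numbers \<open>C\<close>, \<open>E\<close>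
  those of \<open>m' + m\<close>, and \<open>n = j - max \<bar>m\<bar> \<bar>m'\<bar>\<close> is the degree of the Jacobi polynomial.\<close>
lemma spin_weight_parameters:
  assumes "j \<in> spins" "m' \<in> weights j" "m \<in> weights j"
  obtains n A B C E :: nat where "A = 0 \<or> B = 0" "C = 0 \<or> E = 0"
    "j + m' = real (n + A + C)" "j - m' = real (n + B + E)"
    "j + m = real (n + B + C)" "j - m = real (n + A + E)"
proof -
  obtain w k' k where j: "j = real w / 2" and m': "m' = - j + real k'" "m' \<le> j"
    and m: "m = - j + real k" "m \<le> j"
    using assms by (auto simp: spins_def weights_def)
  have le: "k' \<le> w" "k \<le> w"
    using j m' m by simp_all
  let ?l' = "w - k'" and ?l = "w - k"
  show thesis
    by (rule that[of "k' - k" "k - k'" "k - ?l'" "?l' - k" "min (min k' ?l') (min k ?l)"])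
      (use j m' m le in \<open>auto simp: min_def of_nat_diff\<close>)
qed

text \<open>The four linear conditions on \<open>(K, L, M, N)\<close> leave one degree of freedom, here
  \<open>s = min L M\<close>; then \<open>n - s = min K N\<close>.\<close>
lemma D_indices_eq:
  assumes "A = 0 \<or> B = 0" "C = 0 \<or> E = 0"
    and "j + m' = real (n + A + C)" "j - m' = real (n + B + E)"
    and "j + m = real (n + B + C)" "j - m = real (n + A + E)"
  shows "D_indices j m' m = (\<lambda>s. (n - s + C, s + B, s + A, n - s + E)) ` {..n}"
proof -
  have "(K, L, M, N) \<in> D_indices j m' m \<longleftrightarrow>
      K + L = n + B + C \<and> M + N = n + A + E \<and> K + M = n + A + C \<and> L + N = n + B + E"
    for K L M N
    unfolding D_indices_def assms(3-6) by (simp flip: of_nat_add)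
  moreover have "K + L = n + B + C \<and> M + N = n + A + E \<and> K + M = n + A + C \<and> L + N = n + B + E
      \<longleftrightarrow> (\<exists>s\<le>n. K = n - s + C \<and> L = s + B \<and> M = s + A \<and> N = n - s + E)"
    (is "?l \<longleftrightarrow> ?r") for K L M N
  proof
    assume ?l
    then show ?r
      using assms(1,2) by (intro exI[of _ "min L M"]) auto
  next
    assume ?r
    then show ?l by auto
  qed
  ultimately show ?thesis by auto
qed

lemma nat_of_real [simp]: "nat_of (real n) = n"
  by (simp add: nat_of_def)

text \<open>The numerator contains the square root that normalizes a \<open>D\<close>-function, the denominator the
  constant that \<open>jacobi_bernstein_sum\<close> leaves over.\<close>
lemma norm_factor:
  "sqrt (fact (n + a + b) * fact n * fact (n + a) * fact (n + b)) / (fact (n + b) * fact a * fact n)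
    = sqrt (real (((n + a + b) choose a) * ((n + a) choose a)))"
proof -
  have "fact (n + a + b) * fact n * fact (n + a) * fact (n + b)
      = real (((n + a + b) choose a) * ((n + a) choose a)) * (fact (n + b) * fact a * fact n)^2"
    by (simp add: binomial_fact power2_eq_square divide_simps)
  then show ?thesis
    by (simp add: real_sqrt_mult del: of_nat_mult)
qed

text \<open>The four formulas at once: since \<open>n + A + C\<close>, \<open>n + B + E\<close>, \<open>n + B + C\<close>, \<open>n + A + E\<close> are, in some
  order, \<open>n\<close>, \<open>n + a\<close>, \<open>n + b\<close>, \<open>n + a + b\<close> for \<open>a = A + B\<close>, \<open>b = C + E\<close>, neither the
  normalization nor the denominators of the summands depend on the signs of \<open>m' - m\<close> and
  \<open>m' + m\<close>.\<close>
lemma D_fun_eq_jacobi: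
  assumes "A = 0 \<or> B = 0" "C = 0 \<or> E = 0"
    and "j + m' = real (n + A + C)" "j - m' = real (n + B + E)"
    and "j + m = real (n + B + C)" "j - m = real (n + A + E)"
  shows "D_fun h j m' m = in_SLh h
    (complex_of_real (sqrt (real (((n + (A + B) + (C + E)) choose (A + B)) * ((n + (A + B)) choose (A + B)))))
      \<cdot> (jacobi n (real (A + B)) (real (C + E)) (- (\<u> * \<v>)) * residual h A B C E))"
proof -
  let ?a = "A + B" and ?b = "C + E" and ?z = "- (\<u> * \<v>)" and ?R = "residual h A B C E"
  let ?S = "sqrt (fact (nat_of (j + m')) * fact (nat_of (j - m')) *
                  fact (nat_of (j + m)) * fact (nat_of (j - m))) :: real"
  let ?S' = "sqrt (fact (n + ?a + ?b) * fact n * fact (n + ?a) * fact (n + ?b)) :: real"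
  let ?t = "\<lambda>K L M N. (1 / (fact K * fact M * fact L * fact N)) \<cdot>
           (U_prod h M * X_prod h K M * Y_prod h K M N * \<v>^L)"
  have S: "?S = ?S'"
    unfolding assms(3-6) nat_of_real using assms(1,2) by auto
  have denom: "fact (n - s + C) * fact (s + A) * fact (s + B) * fact (n - s + E)
      = (fact (n - s + ?b) * fact (s + ?a) * fact s * fact (n - s) :: complex)" for s
    using assms(1,2) by (elim disjE) (simp_all only: add_0_right add_0_left mult_ac)
  have summand: "(1 / (fact (n - s + C) * fact (s + A) * fact (s + B) * fact (n - s + E)))
      \<cdot> ((1 + \<u> * \<v>) ^ (n - s) * (\<u> * \<v>) ^ s * ?R)
    = (1 / (fact (n - s + ?b) * fact (s + ?a) * fact s * fact (n - s)))
      \<cdot> ((1 - ?z) ^ (n - s) * (- ?z) ^ s) * ?R" for s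
    unfolding denom scale_mult_left by simp
  have "(\<Sum>(K, L, M, N) \<in> D_indices j m' m. ?t K L M N)
      = (\<Sum>s\<le>n. ?t (n - s + C) (s + B) (s + A) (n - s + E))"
    unfolding D_indices_eq[OF assms] by (subst sum.reindex) (auto simp: inj_on_def)
  also have "\<dots> \<simeq>\<^bsub>h\<^esub> (\<Sum>s\<le>n. (1 / (fact (n - s + C) * fact (s + A) * fact (s + B) * fact (n - s + E)))
      \<cdot> ((1 + \<u> * \<v>) ^ (n - s) * (\<u> * \<v>) ^ s * ?R))"
    by (intro cong_sum cong_scale D_term_cong assms(2))
  also have "\<dots> = (\<Sum>s\<le>n. (1 / (fact (n - s + ?b) * fact (s + ?a) * fact s * fact (n - s)))
      \<cdot> ((1 - ?z) ^ (n - s) * (- ?z) ^ s)) * ?R"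
    unfolding sum_distrib_right by (intro sum.cong refl summand)
  also have "\<dots> = (1 / (fact (n + ?b) * fact ?a * fact n)) \<cdot> (jacobi n (real ?a) (real ?b) ?z * ?R)"
    by (simp only: jacobi_bernstein_sum scale_mult_left)
  finally have "complex_of_real ?S \<cdot> (\<Sum>(K, L, M, N) \<in> D_indices j m' m. ?t K L M N)
    \<simeq>\<^bsub>h\<^esub> complex_of_real ?S \<cdot> (1 / (fact (n + ?b) * fact ?a * fact n)) \<cdot> (jacobi n (real ?a) (real ?b) ?z * ?R)"
    by (rule cong_scale)
  also have "\<dots> = complex_of_real (?S' / (fact (n + ?b) * fact ?a * fact n)) \<cdot> (jacobi n (real ?a) (real ?b) ?z * ?R)"
    unfolding S scale_scale by simp
  finally show ?thesis
    unfolding norm_factor cong_SLh_def D_fun_def .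
qed

theorem proposition5p4:
  fixes h :: complex and j m' m :: real and z :: free_alg
  assumes "j \<in> spins" and "m' \<in> weights j" and "m \<in> weights j"
    and "z = - (\<u> * \<v>)"
  shows
    "(m' + m \<ge> 0 \<and> m' \<ge> m \<longrightarrow>
        D_fun h j m' m = in_SLh h (N_plus j m' m \<cdot>
          (jacobi (nat_of (j - m')) (m' - m) (m' + m) z
           * ordered_prod (nat_of (m' - m))
               (\<lambda>i. \<u> + (h * of_nat i) \<cdot> (\<x> + \<y>) + (h^2 * of_nat i ^ 2) \<cdot> \<v>)
           * ordered_prod (nat_of (m' + m))
               (\<lambda>i. \<x> + (h * complex_of_real (m' - m + real i)) \<cdot> \<v>))))
     \<and>
     (m' + m \<ge> 0 \<and> m' \<le> m \<longrightarrow>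
        D_fun h j m' m = in_SLh h (N_minus j m' m \<cdot>
          (jacobi (nat_of (j - m)) (- m' + m) (m' + m) z
           * ordered_prod (nat_of (m' + m)) (\<lambda>i. \<x> + (h * of_nat i) \<cdot> \<v>)
           * \<v> ^ nat_of (- m' + m))))
     \<and>
     (m' + m \<le> 0 \<and> m' \<ge> m \<longrightarrow>
        D_fun h j m' m = in_SLh h (N_plus j m' m \<cdot>
          (jacobi (nat_of (j + m)) (m' - m) (- m' - m) z
           * ordered_prod (nat_of (m' - m))
               (\<lambda>i. \<u> + (h * of_nat i) \<cdot> (\<x> + \<y>) + (h^2 * of_nat i ^ 2) \<cdot> \<v>)
           * ordered_prod (nat_of (- m' - m))
               (\<lambda>i. \<y> - (h * complex_of_real (m - m' - real i)) \<cdot> \<v>))))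
     \<and>
     (m' + m \<le> 0 \<and> m' \<le> m \<longrightarrow>
        D_fun h j m' m = in_SLh h (N_minus j m' m \<cdot>
          (jacobi (nat_of (j + m')) (- m' + m) (- m' - m) z
           * \<v> ^ nat_of (- m' + m)
           * ordered_prod (nat_of (- m' - m))
               (\<lambda>i. \<y> - (h * complex_of_real (m - m' - real i)) \<cdot> \<v>))))"
proof -
  obtain n A B C E :: nat where zero: "A = 0 \<or> B = 0" "C = 0 \<or> E = 0"
    and par: "j + m' = real (n + A + C)" "j - m' = real (n + B + E)"
      "j + m = real (n + B + C)" "j - m = real (n + A + E)"
    by (rule spin_weight_parameters[OF assms(1-3)])
  note D = D_fun_eq_jacobi[OF zero par, of h]
  have diff: "m' - m = real A - real B" "m - m' = real B - real A"
      "- m' + m = real B - real A"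
    and total: "m' + m = real C - real E" "- m' - m = real E - real C"
    using par by linarith+
  have u: "ordered_prod k (\<lambda>i. \<u> + (h * of_nat i) \<cdot> (\<x> + \<y>) + (h^2 * of_nat i ^ 2) \<cdot> \<v>) = run_u h 0 k" for k
    by (simp add: run_u_def shift_u_def)
  have x: "ordered_prod k (\<lambda>i. \<x> + (h * complex_of_real (r + real i)) \<cdot> \<v>)
      = run h \<x> (complex_of_real r) k" for k r
    by (simp add: run_def shift_def)
  have y: "ordered_prod k (\<lambda>i. \<y> - (h * complex_of_real (r - real i)) \<cdot> \<v>)
      = run h \<y> (- complex_of_real r) k" for k r
  proof -
    have "shift h \<y> (- complex_of_real r + of_nat i) = \<y> - (h * complex_of_real (r - real i)) \<cdot> \<v>" for i
      by (simp add: shift_def scale_simps algebra_simps)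
    then show ?thesis by (simp add: run_def)
  qed
  have x0: "ordered_prod k (\<lambda>i. \<x> + (h * of_nat i) \<cdot> \<v>) = run h \<x> 0 k" for k
    by (simp add: run_def shift_def)
  show ?thesis
  proof ((intro conjI impI; elim conjE), goal_cases)
    case 1
    then have "real B \<le> real A" "real E \<le> real C"
      using diff(1) total(1) by linarith+
    then have "B = 0" "E = 0"
      using zero by auto
    then show ?case
      using D unfolding assms(4) N_plus_def par diff total u x
      by (simp add: residual_def mult.assoc flip: of_nat_add)
  next
    case 2
    then have "real A \<le> real B" "real E \<le> real C"
      using diff(1) total(1) by linarith+
    then have "A = 0" "E = 0"
      using zero by auto
    then show ?case
      using D unfolding assms(4) N_minus_def par diff total x0
      by (simp add: residual_def mult.assoc mult.commute flip: of_nat_add)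
  next
    case 3
    then have "real B \<le> real A" "real C \<le> real E"
      using diff(1) total(1) by linarith+
    then have "B = 0" "C = 0"
      using zero by auto
    then show ?case
      using D unfolding assms(4) N_plus_def par diff total u y
      by (simp add: residual_def mult.assoc mult.commute flip: of_nat_add)
  next
    case 4
    then have "real A \<le> real B" "real C \<le> real E"
      using diff(1) total(1) by linarith+
    then have eq: "A = 0" "C = 0"
      using zero by auto
    \<comment> \<open>Only in this case does the stated form have the power of \<open>v\<close> in front, which accounts for
      the index \<open>- B\<close> of its first \<open>y\<close>-factor.\<close>
    have "\<v> ^ B * run h \<y> (- of_nat B) E \<simeq>\<^bsub>h\<^esub> run h \<y> 0 E * \<v> ^ B"
      using v_power_run[of \<y> B h "- of_nat B" E] by simp
    then have "in_SLh h (c \<cdot> (a * (\<v> ^ B * run h \<y> (- of_nat B) E)))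
        = in_SLh h (c \<cdot> (a * (run h \<y> 0 E * \<v> ^ B)))" for c a
      unfolding cong_SLh_def[symmetric] by (intro cong_scale cong_mult_l)
    with eq show ?case
      using D unfolding assms(4) N_minus_def par diff total y
      by (simp add: residual_def mult.assoc flip: of_nat_add)
  qed
qed

end
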